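(* Let $\mathfrak{m}$ be a convex polygon in $\mathbb{R}^2$ with vertex set $\{\mathbf{v}_i\}$. Given any set of generalized barycentric coordinates $\{\lambda_i\}$ associated to $\mathfrak{m}$, $$\frac12\sum_{i,j,k}\lambda_i(\nabla\lambda_j\cdot\operatorname{rot}\nabla\lambda_k)\bigl((\mathbf{v}_j-\mathbf{v}_i)\cdot\operatorname{rot}(\mathbf{v}_k-\mathbf{v}_i)\bigr)=1.$$ Further, for any vector $\mathbf{a}\in\mathbb{R}^2$, $$\frac12\sum_{i,j,k}\bigl(\mathbf{a}^T\mathbf{v}_i\,(\mathbf{v}_j\cdot\operatorname{rot}\mathbf{v}_k)\bigr)\,\lambda_i\nabla\lambda_j\cdot\operatorname{rot}\nabla\lambda_k=\mathbf{a}^T\mathbf{x}.$$ Thus, $\operatorname{span}\{\lambda_i\nabla\lambda_j\cdot\operatorname{rot}\nabla\lambda_k : \mathbf{v}_i,\mathbf{v}_j,\mathbf{v}_k\in\mathfrak{m}\}\supseteq\mathcal{P}_1\Lambda^2(\mathfrak{m})$.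
   Context: Generalized barycentric coordinates on $\mathfrak{m}$: non-negative functions $\lambda_i:\mathfrak{m}\to\mathbb{R}$, one for each vertex $\mathbf{v}_i$, such that every linear function $L$ (polynomial of degree at most 1) satisfies $L=\sum_i L(\mathbf{v}_i)\lambda_i$ on $\mathfrak{m}$. All sums run over all vertex indices of $\mathfrak{m}$ independently. Vectors (vertices, gradients, and the position $\mathbf{x}=(x_1,x_2)^T$) are column vectors; $\mathbf{v}_i\in\mathfrak{m}$ in the span refers to vertices of $\mathfrak{m}$. The operator $\operatorname{rot}$ is left multiplication by the matrix $\begin{bmatrix}0&-1\\1&0\end{bmatrix}$. The $\lambda_i$ are assumed differentiable wherever gradients are written: the identities and the span inclusion are understood as statements about functions of $\mathbf{x}$ on the set of points of $\mathfrak{m}$ at which all $\lambda_i$ are differentiable relative to $\mathfrak{m}$ (i.e. $\lambda_i(\mathbf{y})=\lambda_i(\mathbf{x})+\nabla\lambda_i(\mathbf{x})\cdot(\mathbf{y}-\mathbf{x})+o(|\mathbf{y}-\mathbf{x}|)$ for $\mathbf{y}\in\mathfrak{m}$). $\mathcal{P}_1\Lambda^2(\mathfrak{m})$ is the space of differential 2-forms $p\,dx_1dx_2$ on $\mathfrak{m}$ with $p$ a polynomial of degree at most 1, identified with the scalar functions $p$. Span means finite real linear combinations. *)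

theory Defs
  imports "HOL-Analysis.Analysis" "HOL-Library.Function_Algebras"
begin

definition convex_polygon :: "(real^2) set \<Rightarrow> bool" where
  "convex_polygon m \<longleftrightarrow> polytope m \<and> interior m \<noteq> {}"

definition vertices :: "(real^2) set \<Rightarrow> (real^2) set" where
  "vertices m = {p. p extreme_point_of m}"

definition rot :: "real^2 \<Rightarrow> real^2" where
  "rot u = (vector [vector [0, -1], vector [1, 0]] :: real^2^2) *v u"

text \<open>
  Polynomials of degree at most 1. A 2-form $p\,dx_1dx_2$ is identified with its
  coefficient $p$, so this set also stands for the space $\mathcal{P}_1\Lambda^2$.
\<close>

definition linear_polys :: "(real^2 \<Rightarrow> real) set" where
  "linear_polys = {p. \<exists>a b. p = (\<lambda>x. a \<bullet> x + b)}"

text \<open>Only the values of \<open>lam i\<close> on \<open>m\<close> matter.\<close>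

definition generalized_barycentric ::
  "(real^2) set \<Rightarrow> 'i set \<Rightarrow> ('i \<Rightarrow> real^2) \<Rightarrow> ('i \<Rightarrow> real^2 \<Rightarrow> real) \<Rightarrow> bool" where
  "generalized_barycentric m I v lam \<longleftrightarrow>
     (\<forall>i\<in>I. \<forall>x\<in>m. 0 \<le> lam i x) \<and>
     (\<forall>L\<in>linear_polys. \<forall>x\<in>m. L x = (\<Sum>i\<in>I. L (v i) * lam i x))"

text \<open>
  The gradient relative to \<open>m\<close>, so that boundary points are covered as well. For a
  convex polygon it exists and is unique wherever \<open>f\<close> is differentiable within \<open>m\<close>:
  see \<open>grad_works\<close> and \<open>grad_eqI\<close> below.
\<close>

definition grad :: "(real^2) set \<Rightarrow> (real^2 \<Rightarrow> real) \<Rightarrow> real^2 \<Rightarrow> real^2" where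
  "grad m f x = (THE g. (f has_derivative (\<lambda>h. g \<bullet> h)) (at x within m))"

definition diff_points :: "(real^2) set \<Rightarrow> 'i set \<Rightarrow> ('i \<Rightarrow> real^2 \<Rightarrow> real) \<Rightarrow> (real^2) set" where
  "diff_points m I lam = {x \<in> m. \<forall>i\<in>I. lam i differentiable (at x within m)}"

text \<open>Real-valued functions as a real vector space; \<open>fun_space.span\<close> is the library span in it.\<close>

definition fun_scale :: "real \<Rightarrow> (real^2 \<Rightarrow> real) \<Rightarrow> real^2 \<Rightarrow> real" where
  "fun_scale c f = (\<lambda>x. c * f x)"

interpretation fun_space: vector_space fun_scale
  by unfold_locales (auto simp: fun_scale_def fun_eq_iff algebra_simps)

lemma gradient_unique:
  assumes m: "convex_polygon m" and x: "x \<in> m"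
    and f: "(f has_derivative (\<lambda>h. g \<bullet> h)) (at x within m)"
    and f': "(f has_derivative (\<lambda>h. g' \<bullet> h)) (at x within m)"
  shows "g = g'"
proof -
  define d where "d = g - g'"
  have conv: "convex m"
    using m polytope_imp_convex by (auto simp: convex_polygon_def)
  have D: "((\<lambda>y. 0::real) has_derivative (\<lambda>h. d \<bullet> h)) (at x within m)"
    using has_derivative_diff[OF f f'] by (simp add: d_def inner_diff_left)
  have zero: "d \<bullet> (y - x) = 0" if y: "y \<in> m" for y
  proof -
    define p where "p = (\<lambda>t. x + t *\<^sub>R (y - x))"
    have sub: "p ` {0..1} \<subseteq> m"
    proof
      fix z assume "z \<in> p ` {0..1}"
      then obtain t where t: "0 \<le> t" "t \<le> 1" "z = (1 - t) *\<^sub>R x + t *\<^sub>R y"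
        by (auto simp: p_def algebra_simps)
      then show "z \<in> m"
        using convexD_alt[OF conv x y] by simp
    qed
    have P: "(p has_derivative (\<lambda>t. t *\<^sub>R (y - x))) (at 0 within {0..1})"
      unfolding p_def by (auto intro!: derivative_eq_intros)
    have "((\<lambda>y. 0::real) has_derivative (\<lambda>h. d \<bullet> h)) (at (p 0) within p ` {0..1})"
      using has_derivative_subset[OF D sub] by (simp add: p_def)
    then have "((\<lambda>t. 0::real) has_derivative (\<lambda>t. d \<bullet> (t *\<^sub>R (y - x)))) (at 0 within {0..1})"
      using diff_chain_within[OF P, of "\<lambda>y. 0" "\<lambda>h. d \<bullet> h"] by (simp add: o_def)
    then have "((\<lambda>t. 0::real) has_vector_derivative d \<bullet> (y - x)) (at 0 within {0..1})"
      by (simp add: has_vector_derivative_def)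
    moreover have "((\<lambda>t. 0::real) has_vector_derivative 0) (at 0 within {0..1})"
      by simp
    ultimately show ?thesis
      by (rule vector_derivative_unique_within_closed_interval[of 0 1 0, simplified])
  qed
  obtain z e where e: "e > 0" "cball z e \<subseteq> m"
    using m by (auto simp: convex_polygon_def mem_interior_cball)
  have "d \<bullet> d = 0"
  proof (cases "d = 0")
    case False
    define w where "w = z + (e / norm d) *\<^sub>R d"
    have "w \<in> cball z e" "z \<in> cball z e"
      using e(1) False by (simp_all add: w_def dist_norm)
    then have "w \<in> m" "z \<in> m"
      using e(2) by blast+
    then have "d \<bullet> (w - z) = 0"
      using zero[of w] zero[of z] by (simp add: inner_diff_right)
    then show ?thesis
      using e False by (simp add: w_def)
  qed simp
  then show ?thesis by (simp add: d_def)
qed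

lemma grad_eqI:
  assumes "convex_polygon m" "x \<in> m" "(f has_derivative (\<lambda>h. g \<bullet> h)) (at x within m)"
  shows "grad m f x = g"
  unfolding grad_def
proof (rule the_equality)
  show "(f has_derivative (\<lambda>h. g \<bullet> h)) (at x within m)"
    by (rule assms(3))
  show "g' = g" if "(f has_derivative (\<lambda>h. g' \<bullet> h)) (at x within m)" for g'
    by (rule gradient_unique[OF assms(1,2) that assms(3)])
qed

lemma grad_works:
  assumes "convex_polygon m" "x \<in> m" "f differentiable (at x within m)"
  shows "(f has_derivative (\<lambda>h. grad m f x \<bullet> h)) (at x within m)"
proof -
  obtain F where F: "(f has_derivative F) (at x within m)"
    using assms(3) by (auto simp: differentiable_def)
  then have lin: "linear F"
    using has_derivative_linear by blast
  define g where "g = adjoint F 1"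
  have "F h = g \<bullet> h" for h
    using adjoint_works[OF lin, of h 1] by (simp add: g_def inner_commute[of _ h])
  then have "F = (\<lambda>h. g \<bullet> h)" by (rule ext)
  with F have "(f has_derivative (\<lambda>h. g \<bullet> h)) (at x within m)"
    by simp
  then show ?thesis
    by (simp add: grad_eqI[OF assms(1,2), of f g])
qed

end

theory Submission
  imports Defs
begin

text \<open>
  Differentiating \<open>L = (\<Sum>i. L (v i) * lam i)\<close> shows that the gradients \<open>g i\<close> of the
  coordinates satisfy \<open>(\<Sum>i. g i) = 0\<close> and \<open>(\<Sum>i. (a \<bullet> v i) g i) = a\<close>. Expanding
  both factors by components and separating the sums over \<open>j\<close> and \<open>k\<close>, these relations give
  \<open>(\<Sum>j. \<Sum>k. (g j \<bullet> rot (g k)) * ((v j - p) \<bullet> rot (v k - p))) = 2\<close> for every base point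
  \<open>p\<close>. Taking \<open>p = v i\<close> and \<open>p = 0\<close> and averaging over \<open>i\<close> with the weights \<open>lam i x\<close>
  gives the two identities, and these exhibit every linear polynomial as an element of the span.
\<close>

text \<open>This is minus the determinant with columns \<open>u\<close> and \<open>w\<close>. The
  sign cancels later because such factors occur in pairs.\<close>

lemma inner_rot: "u \<bullet> rot w = u $ 2 * w $ 1 - u $ 1 * w $ 2"
  by (simp add: rot_def matrix_vector_mult_def inner_vec_def sum_2 UNIV_2)

text \<open>The double sum is twice the determinant of the 2 by 2 matrix \<open>S\<close>, the sum
  of the outer products of \<open>v i - p\<close> and \<open>g i\<close>, and \<open>S\<close> is
  the identity.\<close>

lemma sum_inner_rot_inner_rot:
  fixes g v :: "'i \<Rightarrow> real^2"
  assumes g0: "(\<Sum>i\<in>I. g i) = 0"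
    and g1: "\<And>a. (\<Sum>i\<in>I. (a \<bullet> v i) *\<^sub>R g i) = a"
  shows "(\<Sum>j\<in>I. \<Sum>k\<in>I. (g j \<bullet> rot (g k)) * ((v j - p) \<bullet> rot (v k - p))) = 2"
proof -
  define S where "S r s = (\<Sum>i\<in>I. (v i - p) $ r * g i $ s)" for r s
  have S: "S r s = axis r 1 $ s" for r s
  proof -
    \<comment> \<open>The vector \<open>axis r 1\<close> picks out component \<open>r\<close> of
      \<open>v i\<close>; the contribution of \<open>p\<close> vanishes by
      \<open>g0\<close>.\<close>
    have "S r s = (\<Sum>i\<in>I. (axis r 1 \<bullet> v i) *\<^sub>R g i) $ s - p $ r * (\<Sum>i\<in>I. g i) $ s"
      by (simp add: S_def inner_axis' sum_distrib_left sum_subtractf algebra_simps)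
    then show ?thesis
      by (simp add: g0 g1)
  qed
  have "(\<Sum>j\<in>I. \<Sum>k\<in>I. (g j \<bullet> rot (g k)) * ((v j - p) \<bullet> rot (v k - p)))
      = S 2 2 * S 1 1 - S 1 2 * S 2 1 - S 2 1 * S 1 2 + S 1 1 * S 2 2"
    unfolding S_def sum_product sum_subtractf[symmetric] sum.distrib[symmetric]
    by (intro sum.cong refl) (simp add: inner_rot algebra_simps)
  then show ?thesis
    by (simp add: S axis_def)
qed

lemma barycentric_linear:
  assumes "generalized_barycentric m I v lam" "x \<in> m"
  shows "(\<Sum>i\<in>I. (a \<bullet> v i + b) * lam i x) = a \<bullet> x + b"
proof -
  have "(\<lambda>x. a \<bullet> x + b) \<in> linear_polys"
    by (auto simp: linear_polys_def)
  then show ?thesis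
    using assms by (fastforce simp: generalized_barycentric_def)
qed

text \<open>Both sides are gradients relative to \<open>m\<close> of the same affine function, so
  uniqueness of the gradient applies. Keeping \<open>b\<close> covers both relations:
  \<open>a = 0\<close>, \<open>b = 1\<close> and \<open>b = 0\<close>.\<close>

lemma sum_grad_barycentric:
  assumes m: "convex_polygon m"
    and bary: "generalized_barycentric m I v lam"
    and x: "x \<in> diff_points m I lam"
  shows "(\<Sum>i\<in>I. (a \<bullet> v i + b) *\<^sub>R grad m (lam i) x) = a"
proof -
  have xm: "x \<in> m" and diff: "\<And>i. i \<in> I \<Longrightarrow> lam i differentiable (at x within m)"
    using x by (auto simp: diff_points_def)
  have "((\<lambda>y. \<Sum>i\<in>I. (a \<bullet> v i + b) * lam i y) has_derivative
      (\<lambda>h. \<Sum>i\<in>I. (a \<bullet> v i + b) * (grad m (lam i) x \<bullet> h))) (at x within m)"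
    by (intro has_derivative_sum has_derivative_mult_right grad_works[OF m xm diff])
  \<comment> \<open>The sum agrees with the affine function only on \<open>m\<close>, which suffices
    for a derivative within \<open>m\<close> at a point of \<open>m\<close>.\<close>
  then have "((\<lambda>y. a \<bullet> y + b) has_derivative
      (\<lambda>h. (\<Sum>i\<in>I. (a \<bullet> v i + b) *\<^sub>R grad m (lam i) x) \<bullet> h)) (at x within m)"
    by (rule has_derivative_transform[OF xm, rotated, THEN has_derivative_eq_rhs])
      (simp_all add: barycentric_linear[OF bary] inner_sum_left)
  moreover have "((\<lambda>y. a \<bullet> y + b) has_derivative (\<lambda>h. a \<bullet> h)) (at x within m)"
    by (auto intro!: derivative_eq_intros)
  ultimately show ?thesis
    by (rule gradient_unique[OF m xm])
qed

lemma sum_grad_rot_grad: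
  assumes m: "convex_polygon m"
    and bary: "generalized_barycentric m I v lam"
    and x: "x \<in> diff_points m I lam"
  shows "(\<Sum>j\<in>I. \<Sum>k\<in>I. (grad m (lam j) x \<bullet> rot (grad m (lam k) x))
            * ((v j - p) \<bullet> rot (v k - p))) = 2"
  using sum_grad_barycentric[OF assms, of 0 1] sum_grad_barycentric[OF assms, of _ 0]
  by (intro sum_inner_rot_inner_rot) simp_all

text \<open>For each fixed \<open>i\<close> the sum over \<open>j\<close> and \<open>k\<close> gives
  2 for any base point, so the base point \<open>p i\<close> may vary with \<open>i\<close>; linear
  precision then handles the sum over \<open>i\<close>.\<close>

lemma affine_identity:
  assumes m: "convex_polygon m"
    and bary: "generalized_barycentric m I v lam"
    and x: "x \<in> diff_points m I lam"
  shows "1/2 * (\<Sum>i\<in>I. \<Sum>j\<in>I. \<Sum>k\<in>I.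
            ((a \<bullet> v i + b) * ((v j - p i) \<bullet> rot (v k - p i)))
              * (lam i x * (grad m (lam j) x \<bullet> rot (grad m (lam k) x)))) = a \<bullet> x + b"
proof -
  have "(\<Sum>j\<in>I. \<Sum>k\<in>I. ((a \<bullet> v i + b) * ((v j - p i) \<bullet> rot (v k - p i)))
          * (lam i x * (grad m (lam j) x \<bullet> rot (grad m (lam k) x))))
      = (a \<bullet> v i + b) * lam i x * 2" for i
    unfolding sum_grad_rot_grad[OF assms, of "p i", symmetric] sum_distrib_left
    by (intro sum.cong refl) (simp add: mult_ac)
  moreover have "(\<Sum>i\<in>I. (a \<bullet> v i + b) * lam i x) = a \<bullet> x + b"
    using x by (intro barycentric_linear[OF bary]) (simp add: diff_points_def)
  ultimately show ?thesis
    by (simp add: sum_distrib_right[symmetric])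
qed

lemma sum_fun_apply: "(\<Sum>i\<in>A. f i) x = (\<Sum>i\<in>A. f i x)"
  for f :: "'i \<Rightarrow> 'a \<Rightarrow> 'b::comm_monoid_add"
  by (induction A rule: infinite_finite_induct) auto

theorem theorem4p4:
  fixes m :: "(real^2) set"
    and I :: "'i set"
    and v :: "'i \<Rightarrow> real^2"
    and lam :: "'i \<Rightarrow> real^2 \<Rightarrow> real"
  assumes "convex_polygon m"
    and "bij_betw v I (vertices m)"
    and "generalized_barycentric m I v lam"
  shows "(\<forall>x \<in> diff_points m I lam.
            1/2 * (\<Sum>i\<in>I. \<Sum>j\<in>I. \<Sum>k\<in>I.
              lam i x * (grad m (lam j) x \<bullet> rot (grad m (lam k) x))
                * ((v j - v i) \<bullet> rot (v k - v i))) = 1) \<and>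
         (\<forall>a :: real^2. \<forall>x \<in> diff_points m I lam.
            1/2 * (\<Sum>i\<in>I. \<Sum>j\<in>I. \<Sum>k\<in>I.
              ((a \<bullet> v i) * (v j \<bullet> rot (v k)))
                * (lam i x * (grad m (lam j) x \<bullet> rot (grad m (lam k) x)))) = a \<bullet> x) \<and>
         (\<lambda>f. restrict f (diff_points m I lam)) ` linear_polys
           \<subseteq> (\<lambda>f. restrict f (diff_points m I lam)) `
               fun_space.span {(\<lambda>x. lam i x * (grad m (lam j) x \<bullet> rot (grad m (lam k) x))) | i j k.
                               i \<in> I \<and> j \<in> I \<and> k \<in> I}"
proof (intro conjI ballI allI)
  note id = affine_identity[OF assms(1,3)]
  show "1/2 * (\<Sum>i\<in>I. \<Sum>j\<in>I. \<Sum>k\<in>I.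
          lam i x * (grad m (lam j) x \<bullet> rot (grad m (lam k) x))
            * ((v j - v i) \<bullet> rot (v k - v i))) = 1" if "x \<in> diff_points m I lam" for x
    using id[OF that, of 0 1 v] by (simp add: mult_ac)
  show "1/2 * (\<Sum>i\<in>I. \<Sum>j\<in>I. \<Sum>k\<in>I.
          ((a \<bullet> v i) * (v j \<bullet> rot (v k)))
            * (lam i x * (grad m (lam j) x \<bullet> rot (grad m (lam k) x)))) = a \<bullet> x"
    if "x \<in> diff_points m I lam" for a x
    using id[OF that, of a 0 "\<lambda>_. 0"] by simp
  define w where "w i j k = (\<lambda>x. lam i x * (grad m (lam j) x \<bullet> rot (grad m (lam k) x)))" for i j k
  let ?G = "{w i j k | i j k. i \<in> I \<and> j \<in> I \<and> k \<in> I}"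
  have "restrict f (diff_points m I lam) \<in>
      (\<lambda>f. restrict f (diff_points m I lam)) ` fun_space.span ?G" if lin: "f \<in> linear_polys" for f
  proof -
    obtain a b where f: "f = (\<lambda>x. a \<bullet> x + b)"
      using lin by (auto simp: linear_polys_def)
    \<comment> \<open>The coefficients are read off from \<open>affine_identity\<close> with base
      point 0. They do not depend on \<open>x\<close>, so \<open>F\<close> lies in the span; it is
      compared with \<open>f\<close> only on \<open>diff_points m I lam\<close>.\<close>
    define F where "F = (\<Sum>i\<in>I. \<Sum>j\<in>I. \<Sum>k\<in>I.
      fun_scale (1/2 * ((a \<bullet> v i + b) * (v j \<bullet> rot (v k)))) (w i j k))"
    have "F \<in> fun_space.span ?G"
      unfolding F_def
      by (intro fun_space.span_sum fun_space.span_scale fun_space.span_base) blast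
    moreover have "f x = F x" if "x \<in> diff_points m I lam" for x
      using id[OF that, of a b "\<lambda>_. 0"]
      by (simp add: f F_def w_def sum_fun_apply fun_scale_def sum_distrib_left mult_ac)
    then have "restrict f (diff_points m I lam) = restrict F (diff_points m I lam)"
      by (intro restrict_ext)
    ultimately show ?thesis
      by blast
  qed
  then show "(\<lambda>f. restrict f (diff_points m I lam)) ` linear_polys
      \<subseteq> (\<lambda>f. restrict f (diff_points m I lam)) `
          fun_space.span {(\<lambda>x. lam i x * (grad m (lam j) x \<bullet> rot (grad m (lam k) x))) | i j k.
                          i \<in> I \<and> j \<in> I \<and> k \<in> I}"
    unfolding w_def by blast
qed

end
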